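(* Fix $m_1,m_2\ge 1$. In the space of all bimatrix games $(U_1,U_2^t)$ in which player 1 has $m_1$ actions and player 2 has $m_2$ actions, identified with $\mathbb{R}^{2m_1m_2}$, the set of games having a strong Nash equilibrium in which at least one player plays a mixed (i.e. non-pure) strategy has zero (Lebesgue) measure.
   Context: In the bimatrix game $(U_1,U_2^t)$, $U_1\in\mathbb{R}^{m_1\times m_2}$ and $U_2\in\mathbb{R}^{m_2\times m_1}$; a mixed strategy of player $i$ is a vector $x_i$ in the simplex $\Delta_i=\{x_i\in\mathbb{R}^{m_i}: x_i\ge 0,\ \sum_k x_{ik}=1\}$, and it is non-pure if at least two of its components are positive. At the profile $x=(x_1,x_2)$ player 1 gets $v_1(x)=x_1^tU_1x_2$ and player 2 gets $v_2(x)=x_2^tU_2x_1$. A Nash equilibrium is a profile at which no player can strictly increase her own utility by unilaterally changing her mixed strategy. A strong Nash equilibrium is a Nash equilibrium $\bar x$ that is weakly Pareto efficient for every coalition (nonempty subset of players) $C$: there is no profile $y$, with $y_i=\bar x_i$ for all $i\notin C$ and $y_i\in\Delta_i$ for $i\in C$, such that $v_i(y)>v_i(\bar x)$ for all $i\in C$. *)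

theory Defs
  imports "HOL-Analysis.Analysis"
begin

(* In real ^ 'n ^ 'm the row index is 'm and the column index is 'n, so a game (U1, U2)
   with action types 'm1 and 'm2 has an m1 x m2 matrix U1 and an m2 x m1 matrix U2,
   where m1 = CARD('m1) and m2 = CARD('m2). *)

type_synonym ('m1, 'm2) bimatrix_game = "(real ^ 'm2 ^ 'm1) \<times> (real ^ 'm1 ^ 'm2)"

type_synonym ('m1, 'm2) profile = "(real ^ 'm1) \<times> (real ^ 'm2)"

datatype player = Player1 | Player2

definition mixed_strategies :: "(real ^ 'm::finite) set" where
  "mixed_strategies = {x. (\<forall>k. x $ k \<ge> 0) \<and> (\<Sum>k\<in>UNIV. x $ k) = 1}"

definition profiles :: "('m1::finite, 'm2::finite) profile set" where
  "profiles = mixed_strategies \<times> mixed_strategies"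

definition non_pure :: "real ^ 'm::finite \<Rightarrow> bool" where
  "non_pure x \<longleftrightarrow> card {k. x $ k > 0} \<ge> 2"

fun utility ::
  "('m1::finite, 'm2::finite) bimatrix_game \<Rightarrow> player \<Rightarrow> ('m1, 'm2) profile \<Rightarrow> real" where
  "utility (U1, U2) Player1 (x1, x2) = x1 \<bullet> (U1 *v x2)"
| "utility (U1, U2) Player2 (x1, x2) = x2 \<bullet> (U2 *v x1)"

definition deviations ::
  "player set \<Rightarrow> ('m1::finite, 'm2::finite) profile \<Rightarrow> ('m1, 'm2) profile set" where
  "deviations C x = {y \<in> profiles.
     (Player1 \<notin> C \<longrightarrow> fst y = fst x) \<and> (Player2 \<notin> C \<longrightarrow> snd y = snd x)}"

definition nash_equilibrium ::
  "('m1::finite, 'm2::finite) bimatrix_game \<Rightarrow> ('m1, 'm2) profile \<Rightarrow> bool" where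
  "nash_equilibrium G x \<longleftrightarrow>
     x \<in> profiles \<and> (\<forall>i. \<not> (\<exists>y \<in> deviations {i} x. utility G i y > utility G i x))"

definition weakly_pareto_efficient ::
  "('m1::finite, 'm2::finite) bimatrix_game \<Rightarrow> player set \<Rightarrow> ('m1, 'm2) profile \<Rightarrow> bool" where
  "weakly_pareto_efficient G C x \<longleftrightarrow>
     \<not> (\<exists>y \<in> deviations C x. \<forall>i\<in>C. utility G i y > utility G i x)"

definition strong_nash_equilibrium ::
  "('m1::finite, 'm2::finite) bimatrix_game \<Rightarrow> ('m1, 'm2) profile \<Rightarrow> bool" where
  "strong_nash_equilibrium G x \<longleftrightarrow>
     nash_equilibrium G x \<and> (\<forall>C. C \<noteq> {} \<longrightarrow> weakly_pareto_efficient G C x)"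

end

theory Submission
  imports Defs
begin

text \<open>
  If both players mix, the Nash conditions make each player's own utility stationary along her own
  support directions. Unless one player's utility is also stationary along the opponent's support
  directions, both utilities increase to first order when both players deviate, against weak Pareto
  efficiency. So, up to exchanging the players, \<open>U1 x2\<close> is constant on the support of \<open>x1\<close> and both
  \<open>x1\<^sup>t U1\<close> and \<open>U2 x1\<close> are constant on the support of \<open>x2\<close>. With supports of sizes \<open>a\<close> and \<open>b\<close> these
  are \<open>a + 2 b - 1\<close> independent equations in \<open>a + b\<close> unknowns (the strategies and the two constants),
  so for \<open>b \<ge> 2\<close> such games form a smooth image of a hyperplane. If only one player mixes, two
  entries of her payoff matrix coincide.
\<close>

section \<open>Parametrising the games with prescribed indifferences\<close>

lemma differentiable_vec_lambda:
  fixes f :: "'i::finite \<Rightarrow> 'a::euclidean_space \<Rightarrow> 'b::euclidean_space"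
  assumes "\<And>i. f i differentiable F"
  shows "(\<lambda>x. \<chi> i. f i x) differentiable F"
proof -
  have "linear (axis i :: 'b \<Rightarrow> 'b ^ 'i)" for i
    by (rule linearI) (simp_all add: axis_def vec_eq_iff)
  then have "(\<lambda>x. axis i (f i x)) differentiable F" for i
    using assms[of i] bounded_linear.has_derivative unfolding differentiable_def linear_conv_bounded_linear
    by blast
  then have "(\<lambda>x. \<Sum>i\<in>UNIV. axis i (f i x)) differentiable F"
    by (intro differentiable_sum) auto
  moreover have "(\<chi> i. f i x) = (\<Sum>i\<in>UNIV. axis i (f i x))" for x
    by (simp add: vec_eq_iff axis_def)
  ultimately show ?thesis by simp
qed

text \<open>Since the weights sum to one, subtracting \<open>v\<close> makes the equation
  homogeneous, so it can be solved for entry \<open>j\<close>. Only the ratios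
  \<open>x $ i / x $ j\<close> enter, one parameter fewer than the support has elements.\<close>

lemma sum_support_split:
  fixes x :: "real ^ 'n::finite"
  assumes zero: "(\<Sum>i\<in>UNIV. c i * x $ i) = (v::real)" and one: "(\<Sum>i\<in>UNIV. x $ i) = 1"
    and supp: "\<And>i. i \<notin> S \<Longrightarrow> x $ i = 0" and j: "j \<in> S" "x $ j \<noteq> 0"
  shows "c j - v = - (\<Sum>i\<in>S - {j}. (c i - v) * (x $ i / x $ j))"
proof -
  have "(\<Sum>i\<in>UNIV. (c i - v) * x $ i) = v - v * (\<Sum>i\<in>UNIV. x $ i)"
    by (simp add: left_diff_distrib sum_subtractf zero flip: sum_distrib_left)
  then have "(\<Sum>i\<in>UNIV. (c i - v) * x $ i) = 0" by (simp add: one)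
  also have "(\<Sum>i\<in>UNIV. (c i - v) * x $ i) = (\<Sum>i\<in>S. (c i - v) * x $ i)"
    by (rule sum.mono_neutral_right) (auto simp: supp)
  also have "\<dots> = (c j - v) * x $ j + (\<Sum>i\<in>S - {j}. (c i - v) * x $ i)"
    by (rule sum.remove) (auto simp: j)
  finally have "(c j - v) = - (\<Sum>i\<in>S - {j}. (c i - v) * x $ i) / x $ j"
    using j by (simp add: field_simps)
  then show ?thesis by (simp add: sum_divide_distrib)
qed

lemma negligible_swap:
  fixes S :: "('a::euclidean_space \<times> 'b::euclidean_space) set"
  assumes "negligible S"
  shows "negligible (prod.swap ` S)"
proof (rule negligible_differentiable_image_negligible[OF _ assms])
  show "prod.swap differentiable_on S"
    unfolding prod.swap_def[abs_def] by (intro linear_imp_differentiable_on linearI) auto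
qed simp

lemma negligible_doubly_indifferent:
  fixes S :: "'m::finite set" and T :: "'n::finite set"
  assumes k1: "k1 \<in> S" and l1: "l1 \<in> T" and l2: "l2 \<in> T" "l1 \<noteq> l2"
  shows "negligible {(A :: real ^ 'n ^ 'm, B :: real ^ 'm ^ 'n). \<exists>x y v w.
    (\<forall>k. k \<notin> S \<longrightarrow> x $ k = 0) \<and> (\<forall>l. l \<notin> T \<longrightarrow> y $ l = 0) \<and> x $ k1 \<noteq> 0 \<and> y $ l1 \<noteq> 0 \<and>
    (\<Sum>k\<in>UNIV. x $ k) = 1 \<and> (\<Sum>l\<in>UNIV. y $ l) = 1 \<and>
    (\<forall>k\<in>S. (A *v y) $ k = v) \<and> (\<forall>l\<in>T. (x v* A) $ l = v) \<and> (\<forall>l\<in>T. (B *v x) $ l = w)}"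
    (is "negligible ?Bad")
proof -
  \<comment> \<open>After subtracting \<open>v\<close> and \<open>w\<close>, the conditions express the entries of \<open>A\<close> in column \<open>l1\<close> (\<open>C\<close>)
    and row \<open>k1\<close> (\<open>D\<close>) and those of \<open>B\<close> in column \<open>k1\<close> (\<open>E\<close>) through the others. The vacated
    positions store the parameters: \<open>x\<close> and \<open>y\<close> normalised at \<open>k1\<close>, \<open>l1\<close>, and \<open>v\<close>, \<open>w\<close>. The position
    \<open>(l2, k1)\<close> of \<open>B\<close> stays unused, which places the parameters in a hyperplane.\<close>
  define C :: "(real ^ 'n ^ 'm) \<times> (real ^ 'm ^ 'n) \<Rightarrow> 'm \<Rightarrow> 'n \<Rightarrow> real" where
    "C p k l = (if l = l1 \<and> k \<in> S then - (\<Sum>j\<in>T - {l1}. fst p $ k $ j * fst p $ k1 $ j)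
       else fst p $ k $ l)" for p k l
  define D :: "(real ^ 'n ^ 'm) \<times> (real ^ 'm ^ 'n) \<Rightarrow> 'm \<Rightarrow> 'n \<Rightarrow> real" where
    "D p k l = (if k = k1 \<and> l \<in> T then - (\<Sum>i\<in>S - {k1}. C p i l * fst p $ i $ l1)
       else C p k l)" for p k l
  define E :: "(real ^ 'n ^ 'm) \<times> (real ^ 'm ^ 'n) \<Rightarrow> 'n \<Rightarrow> 'm \<Rightarrow> real" where
    "E p l k = (if k = k1 \<and> l \<in> T then - (\<Sum>i\<in>S - {k1}. snd p $ l $ i * fst p $ i $ l1)
       else snd p $ l $ k)" for p k l
  define f :: "(real ^ 'n ^ 'm) \<times> (real ^ 'm ^ 'n) \<Rightarrow> (real ^ 'n ^ 'm) \<times> (real ^ 'm ^ 'n)" where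
    "f p = (\<chi> k l. D p k l + fst p $ k1 $ l1, \<chi> l k. E p l k + snd p $ l1 $ k1)" for p
  define H :: "((real ^ 'n ^ 'm) \<times> (real ^ 'm ^ 'n)) set" where "H = {p. snd p $ l2 $ k1 = 0}"
  have "negligible {p :: (real ^ 'n ^ 'm) \<times> (real ^ 'm ^ 'n). (0, axis l2 (axis k1 1)) \<bullet> p = 0}"
    by (rule negligible_hyperplane) (auto simp: axis_eq_0_iff zero_prod_def)
  then have H: "negligible H"
    unfolding H_def by (simp add: inner_prod_def inner_axis')
  have [intro]: "(\<lambda>p. fst p $ k $ l) differentiable F" "(\<lambda>p. snd p $ l $ k) differentiable F"
    for k l and F :: "((real ^ 'n ^ 'm) \<times> (real ^ 'm ^ 'n)) filter"
    by (intro bounded_linear_imp_differentiable bounded_linear_compose[OF bounded_linear_vec_nth]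
        bounded_linear_fst bounded_linear_snd)+
  have C: "(\<lambda>p. C p k l) differentiable at p" for p k l
    unfolding C_def by (cases "l = l1 \<and> k \<in> S") (auto intro!: derivative_intros)
  have D: "(\<lambda>p. D p k l) differentiable at p" for p k l
    unfolding D_def by (cases "k = k1 \<and> l \<in> T") (auto intro!: derivative_intros C)
  have E: "(\<lambda>p. E p l k) differentiable at p" for p k l
    unfolding E_def by (cases "k = k1 \<and> l \<in> T") (auto intro!: derivative_intros)
  have "f differentiable at p" for p
    unfolding f_def by (intro differentiable_Pair differentiable_vec_lambda differentiable_add D E) auto
  then have "f differentiable_on H"
    by (simp add: differentiable_at_imp_differentiable_on)
  then have "negligible (f ` H)"
    by (intro negligible_differentiable_image_negligible H) auto
  moreover have "?Bad \<subseteq> f ` H"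
  proof clarify
    fix A :: "real ^ 'n ^ 'm" and B :: "real ^ 'm ^ 'n" and x y v w
    assume x: "\<forall>k. k \<notin> S \<longrightarrow> x $ k = 0" "x $ k1 \<noteq> 0" "(\<Sum>k\<in>UNIV. x $ k) = 1"
      and y: "\<forall>l. l \<notin> T \<longrightarrow> y $ l = 0" "y $ l1 \<noteq> 0" "(\<Sum>l\<in>UNIV. y $ l) = 1"
      and Ay: "\<forall>k\<in>S. (A *v y) $ k = v" and xA: "\<forall>l\<in>T. (x v* A) $ l = v"
      and Bx: "\<forall>l\<in>T. (B *v x) $ l = w"
    \<comment> \<open>The preimage of \<open>(A, B)\<close> under \<open>f\<close>. In column
      \<open>k1\<close> of the second matrix \<open>E\<close> overwrites every row of
      \<open>T\<close>, so besides \<open>w\<close> in row \<open>l1\<close> any value may stand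
      there; zero puts \<open>p\<close> into \<open>H\<close>.\<close>
    define p where "p = 
      ((\<chi> k l. if k = k1 \<and> l = l1 then v else if k = k1 \<and> l \<in> T then y $ l / y $ l1
         else if l = l1 \<and> k \<in> S then x $ k / x $ k1 else A $ k $ l - v) :: real ^ 'n ^ 'm,
       (\<chi> l k. if k = k1 \<and> l \<in> T then (if l = l1 then w else 0) else B $ l $ k - w) :: real ^ 'm ^ 'n)"
    have "p \<in> H" unfolding H_def p_def using l2 by simp
    have y': "A $ k $ l1 - v = - (\<Sum>l\<in>T - {l1}. (A $ k $ l - v) * (y $ l / y $ l1))" if "k \<in> S" for k
      using that Ay y l1 by (intro sum_support_split) (auto simp: matrix_vector_mult_def)
    have x': "A $ k1 $ l - v = - (\<Sum>k\<in>S - {k1}. (A $ k $ l - v) * (x $ k / x $ k1))" if "l \<in> T" for l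
      using that xA x k1 by (intro sum_support_split[where c = "\<lambda>k. A $ k $ l"]) (auto simp: vector_matrix_mult_def mult.commute)
    have z': "B $ l $ k1 - w = - (\<Sum>k\<in>S - {k1}. (B $ l $ k - w) * (x $ k / x $ k1))" if "l \<in> T" for l
      using that Bx x k1 by (intro sum_support_split) (auto simp: matrix_vector_mult_def)
    \<comment> \<open>Row \<open>k1\<close> holds parameters in the columns of \<open>T\<close>, so
      \<open>C\<close> recovers the shifted \<open>A\<close> only elsewhere. \<open>D\<close> fills
      that gap from the rows \<open>i \<noteq> k1\<close>, which include the entries of column
      \<open>l1\<close> just recovered.\<close>
    have Cp: "C p k l = A $ k $ l - v" if "k \<noteq> k1 \<or> l \<notin> T" for k l
    proof (cases "l = l1 \<and> k \<in> S")
      case True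
      then have "k \<noteq> k1" using that l1 by auto
      then show ?thesis using True y'[of k] unfolding C_def
        by (auto simp: p_def intro!: sum.cong)
    qed (use that l1 in \<open>auto simp: C_def p_def\<close>)
    have Dp: "D p k l = A $ k $ l - v" for k l
    proof (cases "k = k1 \<and> l \<in> T")
      case True
      then show ?thesis using x'[of l] l1 unfolding D_def
        by (auto simp: Cp) (auto simp: p_def intro!: sum.cong)
    qed (auto simp: D_def Cp)
    have Ep: "E p l k = B $ l $ k - w" for k l
    proof (cases "k = k1 \<and> l \<in> T")
      case True
      then show ?thesis using z'[of l] l1 unfolding E_def
        by (auto simp: p_def intro!: sum.cong)
    qed (auto simp: E_def p_def)
    have "f p = (A, B)"
      unfolding f_def Dp Ep using l1 by (simp add: p_def vec_eq_iff)
    with \<open>p \<in> H\<close> show "(A, B) \<in> f ` H" by (metis image_eqI)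
  qed
  ultimately show ?thesis by (rule negligible_subset)
qed

section \<open>Mixed strategies and best responses\<close>

lemma mixed_strategies_shift:
  assumes "x \<in> mixed_strategies" "i \<noteq> j" "0 \<le> e" "e \<le> x $ i"
  shows "x + e *\<^sub>R (axis j 1 - axis i 1) \<in> mixed_strategies"
proof -
  have "(\<Sum>k\<in>UNIV. (x + e *\<^sub>R (axis j 1 - axis i 1)) $ k) = (\<Sum>k\<in>UNIV. x $ k)"
    by (simp add: sum.distrib sum_subtractf axis_def flip: sum_distrib_left)
  then show ?thesis
    using assms unfolding mixed_strategies_def by (auto simp: axis_def)
qed

lemma mixed_strategies_axis: "axis k 1 \<in> mixed_strategies"
  unfolding mixed_strategies_def by (auto simp: axis_def)

lemma mixed_strategies_pure:
  assumes "x \<in> mixed_strategies" "\<not> non_pure x"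
  obtains k where "x = axis k 1"
proof -
  have x: "\<And>k. 0 \<le> x $ k" "(\<Sum>k\<in>UNIV. x $ k) = 1"
    using assms by (auto simp: mixed_strategies_def)
  then obtain k where k: "x $ k > 0"
    by (metis less_eq_real_def sum.neutral zero_neq_one)
  have zero: "x $ l = 0" if "l \<noteq> k" for l
  proof (rule ccontr)
    assume "x $ l \<noteq> 0"
    then have "{k, l} \<subseteq> {k. x $ k > 0}" using k x(1)[of l] by auto
    then have "card {k, l} \<le> card {k. x $ k > 0}" by (intro card_mono) auto
    with that assms(2) show False by (simp add: non_pure_def)
  qed
  have "(\<Sum>l\<in>UNIV. x $ l) = (\<Sum>l\<in>{k}. x $ l)"
    by (rule sum.mono_neutral_right) (auto simp: zero)
  then have "x = axis k 1" using x zero by (auto simp: vec_eq_iff axis_def)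
  then show ?thesis by (rule that)
qed

lemma non_pure_obtain:
  assumes "non_pure x"
  obtains k l where "k \<noteq> l" "x $ k > 0" "x $ l > 0"
proof -
  have "\<exists>k l. k \<in> {k. x $ k > 0} \<and> l \<in> {k. x $ k > 0} \<and> k \<noteq> l"
    using assms unfolding non_pure_def
    by (metis One_nat_def card_le_Suc0_iff_eq finite not_less_eq_eq numeral_2_eq_2)
  then show ?thesis using that by auto
qed

text \<open>Comparison with pure strategies bounds every \<open>c $ l\<close> by
  \<open>x \<bullet> c\<close>, which is the average of these entries with weights \<open>x\<close>.
  Hence each entry of positive weight attains the bound.\<close>

lemma best_response_support:
  assumes x: "x \<in> mixed_strategies" and best: "\<And>y. y \<in> mixed_strategies \<Longrightarrow> y \<bullet> c \<le> x \<bullet> c"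
    and k: "x $ k > 0"
  shows "c $ k = x \<bullet> c"
proof -
  have le: "c $ l \<le> x \<bullet> c" for l
    using best[OF mixed_strategies_axis, of l] by (simp add: inner_axis')
  have "(\<Sum>l\<in>UNIV. x $ l * (x \<bullet> c - c $ l)) = (\<Sum>l\<in>UNIV. x $ l) * (x \<bullet> c) - x \<bullet> c"
    by (simp add: right_diff_distrib sum_subtractf sum_distrib_right inner_vec_def)
  also have "\<dots> = 0" using x by (simp add: mixed_strategies_def)
  finally have "x $ k * (x \<bullet> c - c $ k) = 0"
    using x le by (subst (asm) sum_nonneg_eq_0_iff) (auto simp: mixed_strategies_def)
  then show ?thesis using k by simp
qed

lemma nash_equilibrium_support:
  assumes "nash_equilibrium (A, B) (x, y)"
  shows "x \<in> mixed_strategies" "y \<in> mixed_strategies"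
    "x $ k > 0 \<Longrightarrow> (A *v y) $ k = x \<bullet> (A *v y)"
    "y $ l > 0 \<Longrightarrow> (B *v x) $ l = y \<bullet> (B *v x)"
proof -
  show x: "x \<in> mixed_strategies" and y: "y \<in> mixed_strategies"
    using assms by (auto simp: nash_equilibrium_def profiles_def)
  have no_gain: "\<not> utility (A, B) i z > utility (A, B) i (x, y)" if "z \<in> deviations {i} (x, y)" for i z
    using assms that unfolding nash_equilibrium_def by blast
  have "x' \<bullet> (A *v y) \<le> x \<bullet> (A *v y)" if "x' \<in> mixed_strategies" for x'
    using no_gain[of "(x', y)" Player1] that y by (simp add: deviations_def profiles_def not_less)
  then show "x $ k > 0 \<Longrightarrow> (A *v y) $ k = x \<bullet> (A *v y)"
    by (rule best_response_support[OF x])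
  have "y' \<bullet> (B *v x) \<le> y \<bullet> (B *v x)" if "y' \<in> mixed_strategies" for y'
    using no_gain[of "(x, y')" Player2] that x by (simp add: deviations_def profiles_def not_less)
  then show "y $ l > 0 \<Longrightarrow> (B *v x) $ l = y \<bullet> (B *v x)"
    by (rule best_response_support[OF y])
qed

section \<open>First-order gains from joint deviations\<close>

text \<open>In the expansion in \<open>e\<close> the linear coefficient is the sum of the two
  quantities in the assumptions, hence positive, and it dominates the quadratic term
  \<open>e * e * (d \<bullet> (A *v d'))\<close> for small \<open>e > 0\<close>.\<close>

lemma eventually_bilinear_increase:
  fixes A :: "real ^ 'n::finite ^ 'm::finite"
  assumes "d \<bullet> (A *v y) = 0" "(x v* A) \<bullet> d' > 0"
  shows "\<forall>\<^sub>F e in at_right 0. (x + e *\<^sub>R d) \<bullet> (A *v (y + e *\<^sub>R d')) > x \<bullet> (A *v y)"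
proof -
  have "((\<lambda>e. (x v* A) \<bullet> d' + e * (d \<bullet> (A *v d'))) \<longlongrightarrow> (x v* A) \<bullet> d' + 0 * (d \<bullet> (A *v d'))) (at_right 0)"
    by (intro tendsto_intros)
  then have "\<forall>\<^sub>F e in at_right 0. (x v* A) \<bullet> d' + e * (d \<bullet> (A *v d')) > 0"
    using assms(2) by (intro order_tendstoD(1)) auto
  then show ?thesis
    using eventually_at_right_less[of 0]
  proof eventually_elim
    case (elim e)
    have "(x + e *\<^sub>R d) \<bullet> (A *v (y + e *\<^sub>R d')) =
        x \<bullet> (A *v y) + e * (d \<bullet> (A *v y)) + e * ((x v* A) \<bullet> d' + e * (d \<bullet> (A *v d')))"
      by (simp add: matrix_vector_right_distrib matrix_vector_mult_scaleR inner_simps dot_lmul_matrix algebra_simps)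
    then show ?case using elim assms(1) by simp
  qed
qed

lemma strong_nash_equilibrium_indifferent:
  fixes A :: "real ^ 'n::finite ^ 'm::finite" and B :: "real ^ 'm ^ 'n"
  assumes strong: "strong_nash_equilibrium (A, B) (x, y)"
  shows "(\<forall>l l'. y $ l > 0 \<longrightarrow> y $ l' > 0 \<longrightarrow> (x v* A) $ l = (x v* A) $ l') \<or>
    (\<forall>k k'. x $ k > 0 \<longrightarrow> x $ k' > 0 \<longrightarrow> (y v* B) $ k = (y v* B) $ k')"
proof (rule ccontr)
  assume "\<not> ?thesis"
  then obtain l l' k k' where l: "y $ l > 0" "y $ l' > 0" "(x v* A) $ l < (x v* A) $ l'"
    and k: "x $ k > 0" "x $ k' > 0" "(y v* B) $ k < (y v* B) $ k'"
    by (metis linorder_neqE_linordered_idom)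
  \<comment> \<open>Each player moves mass, inside her own support, towards the action that the
    opponent prefers: \<open>d\<close> serves player 2 and \<open>d'\<close> serves player 1. By the
    Nash conditions a player's own move costs her nothing to first order.\<close>
  define d where "d = axis k' 1 - (axis k 1 :: real ^ 'm)"
  define d' where "d' = axis l' 1 - (axis l 1 :: real ^ 'n)"
  have nash: "nash_equilibrium (A, B) (x, y)"
    and eff: "weakly_pareto_efficient (A, B) UNIV (x, y)"
    using strong by (auto simp: strong_nash_equilibrium_def)
  note supp = nash_equilibrium_support[OF nash]
  have "d \<bullet> (A *v y) = 0"
    using supp(3)[OF k(1)] supp(3)[OF k(2)] by (simp add: d_def inner_diff_left inner_axis')
  moreover have "(x v* A) \<bullet> d' > 0"
    using l(3) by (simp add: d'_def inner_diff_right inner_axis)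
  ultimately have 1: "\<forall>\<^sub>F e in at_right 0. (x + e *\<^sub>R d) \<bullet> (A *v (y + e *\<^sub>R d')) > x \<bullet> (A *v y)"
    by (rule eventually_bilinear_increase)
  have "d' \<bullet> (B *v x) = 0"
    using supp(4)[OF l(1)] supp(4)[OF l(2)] by (simp add: d'_def inner_diff_left inner_axis')
  moreover have "(y v* B) \<bullet> d > 0"
    using k(3) by (simp add: d_def inner_diff_right inner_axis)
  ultimately have 2: "\<forall>\<^sub>F e in at_right 0. (y + e *\<^sub>R d') \<bullet> (B *v (x + e *\<^sub>R d)) > y \<bullet> (B *v x)"
    by (rule eventually_bilinear_increase)
  \<comment> \<open>The bounds by \<open>x $ k\<close> and \<open>y $ l\<close> keep the shifted
    vectors nonnegative.\<close>
  have "\<forall>\<^sub>F e in at_right 0. 0 < e \<and> e < x $ k \<and> e < y $ l \<and>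
      (x + e *\<^sub>R d) \<bullet> (A *v (y + e *\<^sub>R d')) > x \<bullet> (A *v y) \<and>
      (y + e *\<^sub>R d') \<bullet> (B *v (x + e *\<^sub>R d)) > y \<bullet> (B *v x)"
    using 1 2 k(1) l(1)
    by (intro eventually_conj eventually_at_right_less eventually_at_right_real order_tendstoD(2)[OF tendsto_ident_at])
  then obtain e where e: "0 < e" "e < x $ k" "e < y $ l"
      "(x + e *\<^sub>R d) \<bullet> (A *v (y + e *\<^sub>R d')) > x \<bullet> (A *v y)"
      "(y + e *\<^sub>R d') \<bullet> (B *v (x + e *\<^sub>R d)) > y \<bullet> (B *v x)"
    using eventually_happens trivial_limit_at_right_real by blast
  have "k \<noteq> k'" "l \<noteq> l'" using k l by auto
  then have "(x + e *\<^sub>R d, y + e *\<^sub>R d') \<in> deviations UNIV (x, y)"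
    using e supp(1,2) unfolding d_def d'_def
    by (auto simp: deviations_def profiles_def intro!: mixed_strategies_shift)
  moreover have "utility (A, B) i (x + e *\<^sub>R d, y + e *\<^sub>R d') > utility (A, B) i (x, y)" for i
    using e by (cases i) auto
  ultimately show False using eff unfolding weakly_pareto_efficient_def by blast
qed

section \<open>The null set containing all exceptional games\<close>

text \<open>Necessary conditions for the games in question, with the roles fixed so that the second
  player mixes and, if both mix, the first player is indifferent to shifts within the second
  player's support. The other cases arise by exchanging the players.\<close>

definition degenerate_games :: "('m1::finite, 'm2::finite) bimatrix_game set" where
  "degenerate_games = {(A, B). \<exists>x y. x \<in> mixed_strategies \<and> y \<in> mixed_strategies \<and> non_pure y \<and>
     (\<forall>k. x $ k > 0 \<longrightarrow> (A *v y) $ k = x \<bullet> (A *v y)) \<and>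
     (\<forall>l. y $ l > 0 \<longrightarrow> (B *v x) $ l = y \<bullet> (B *v x)) \<and>
     (\<not> non_pure x \<or> (\<forall>l l'. y $ l > 0 \<longrightarrow> y $ l' > 0 \<longrightarrow> (x v* A) $ l = (x v* A) $ l'))}"

lemma negligible_degenerate_games:
  "negligible (degenerate_games :: ('m1::finite, 'm2::finite) bimatrix_game set)"
proof -
  \<comment> \<open>\<open>P k l l'\<close> is the hyperplane on which the entries
    \<open>(l, k)\<close> and \<open>(l', k)\<close> of the second matrix coincide; \<open>Q\<close>
    collects the games with double indifference on given supports.\<close>
  define P :: "'m1 \<Rightarrow> 'm2 \<Rightarrow> 'm2 \<Rightarrow> ('m1, 'm2) bimatrix_game set" where
    "P k l l' = {G. (0, axis l (axis k 1) - axis l' (axis k 1)) \<bullet> G = 0}" for k l l'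
  define Q :: "'m1 set \<Rightarrow> 'm2 set \<Rightarrow> 'm1 \<Rightarrow> 'm2 \<Rightarrow> ('m1, 'm2) bimatrix_game set" where
    "Q S T k1 l1 = {(A, B). \<exists>x y v w.
      (\<forall>k. k \<notin> S \<longrightarrow> x $ k = 0) \<and> (\<forall>l. l \<notin> T \<longrightarrow> y $ l = 0) \<and> x $ k1 \<noteq> 0 \<and> y $ l1 \<noteq> 0 \<and>
      (\<Sum>k\<in>UNIV. x $ k) = 1 \<and> (\<Sum>l\<in>UNIV. y $ l) = 1 \<and>
      (\<forall>k\<in>S. (A *v y) $ k = v) \<and> (\<forall>l\<in>T. (x v* A) $ l = v) \<and> (\<forall>l\<in>T. (B *v x) $ l = w)}"
    for S T k1 l1
  have P: "negligible (P k l l')" if "l \<noteq> l'" for k l l'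
    unfolding P_def using that
    by (intro negligible_hyperplane) (auto simp: zero_prod_def axis_eq_axis)
  have Q: "negligible (Q S T k1 l1)" if "k1 \<in> S" "l1 \<in> T" "l2 \<in> T" "l1 \<noteq> l2" for S T k1 l1 l2
    unfolding Q_def using that by (rule negligible_doubly_indifferent)
  have "negligible (\<Union>(k, l, l') \<in> {(k, l, l'). l \<noteq> l'}. P k l l')"
    using P by (intro negligible_Union) auto
  moreover have "negligible (\<Union>(S, T, k1, l1) \<in> {(S, T, k1, l1). k1 \<in> S \<and> l1 \<in> T \<and> (\<exists>l2\<in>T. l1 \<noteq> l2)}. Q S T k1 l1)"
    using Q by (intro negligible_Union) (auto intro: finite_subset[OF subset_UNIV])
  ultimately have "negligible ((\<Union>(k, l, l') \<in> {(k, l, l'). l \<noteq> l'}. P k l l') \<union>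
    (\<Union>(S, T, k1, l1) \<in> {(S, T, k1, l1). k1 \<in> S \<and> l1 \<in> T \<and> (\<exists>l2\<in>T. l1 \<noteq> l2)}. Q S T k1 l1))"
    (is "negligible ?U") by (rule negligible_Un)
  moreover have "degenerate_games \<subseteq> ?U"
  proof (rule subsetI, unfold degenerate_games_def, clarify)
    fix A :: "real ^ 'm2 ^ 'm1" and B :: "real ^ 'm1 ^ 'm2" and x y
    assume xy: "x \<in> mixed_strategies" "y \<in> mixed_strategies" "non_pure y"
      and A: "\<forall>k. x $ k > 0 \<longrightarrow> (A *v y) $ k = x \<bullet> (A *v y)"
      and B: "\<forall>l. y $ l > 0 \<longrightarrow> (B *v x) $ l = y \<bullet> (B *v x)"
      and disj: "\<not> non_pure x \<or> (\<forall>l l'. y $ l > 0 \<longrightarrow> y $ l' > 0 \<longrightarrow> (x v* A) $ l = (x v* A) $ l')"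
      and notQ: "(A, B) \<notin> (\<Union>(S, T, k1, l1) \<in> {(S, T, k1, l1). k1 \<in> S \<and> l1 \<in> T \<and> (\<exists>l2\<in>T. l1 \<noteq> l2)}. Q S T k1 l1)"
    obtain l l' where l: "l \<noteq> l'" "y $ l > 0" "y $ l' > 0"
      using non_pure_obtain[OF xy(3)] .
    have x: "\<And>k. 0 \<le> x $ k" "(\<Sum>k\<in>UNIV. x $ k) = 1" and y: "\<And>k. 0 \<le> y $ k" "(\<Sum>k\<in>UNIV. y $ k) = 1"
      using xy by (auto simp: mixed_strategies_def)
    have "\<not> non_pure x"
    proof
      assume "non_pure x"
      then obtain k1 where k1: "x $ k1 > 0" using non_pure_obtain by blast
      have const: "(x v* A) $ m = (x v* A) $ l" if "y $ m > 0" for m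
        using disj \<open>non_pure x\<close> l that by blast
      \<comment> \<open>\<open>Q\<close> demands the same \<open>v\<close> for rows and columns.
        Averaging the constant value of \<open>x v* A\<close> on the support of \<open>y\<close>
        with weights \<open>y\<close> identifies it as \<open>x \<bullet> (A *v y)\<close>, the
        value of the rows.\<close>
      have "(x v* A) $ m * y $ m = (x v* A) $ l * y $ m" for m
      proof (cases "y $ m = 0")
        case False
        then have "y $ m > 0" using y(1)[of m] by simp
        from const[OF this] show ?thesis by simp
      qed simp
      then have "(x v* A) \<bullet> y = (\<Sum>m\<in>UNIV. (x v* A) $ l * y $ m)"
        by (simp only: inner_vec_def inner_real_def)
      then have v: "(x v* A) $ l = x \<bullet> (A *v y)"
        by (simp add: y dot_lmul_matrix flip: sum_distrib_left)
      have "(A, B) \<in> Q {k. x $ k > 0} {l. y $ l > 0} k1 l" (is "_ \<in> Q ?S ?T k1 l")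
        unfolding Q_def mem_Collect_eq case_prod_conv
      proof (intro exI conjI)
        show "\<forall>m. \<not> x $ m > 0 \<longrightarrow> x $ m = 0" "\<forall>m. \<not> y $ m > 0 \<longrightarrow> y $ m = 0"
          using x(1) y(1) by (simp_all add: not_less order.eq_iff)
        show "\<forall>m\<in>{l. y $ l > 0}. (x v* A) $ m = x \<bullet> (A *v y)"
          using const v by auto
        show "\<forall>m\<in>{l. y $ l > 0}. (B *v x) $ m = y \<bullet> (B *v x)"
          using B by auto
      qed (use A k1 l x y in auto)
      then have in_Q: "(A, B) \<in> (case (?S, ?T, k1, l) of (S, T, k1, l1) \<Rightarrow> Q S T k1 l1)"
        by (simp only: case_prod_conv)
      have "(?S, ?T, k1, l) \<in> {(S, T, k1, l1). k1 \<in> S \<and> l1 \<in> T \<and> (\<exists>l2\<in>T. l1 \<noteq> l2)}"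
        using k1 l by auto
      from notQ UN_I[where B = "\<lambda>(S, T, k1, l1). Q S T k1 l1", OF this in_Q] show False by (rule notE)
    qed
    then obtain k where k: "x = axis k 1"
      using mixed_strategies_pure xy(1) by blast
    \<comment> \<open>Against the pure strategy \<open>k\<close>, the payoffs \<open>B *v x\<close>
      are column \<open>k\<close> of \<open>B\<close>, and both \<open>l\<close> and
      \<open>l'\<close> are best replies.\<close>
    have "B $ l $ k = B $ l' $ k"
      using B l unfolding k by (simp add: matrix_vector_mult_basis column_def)
    then have "(A, B) \<in> P k l l'"
      by (simp add: P_def inner_diff_left inner_axis')
    with l(1) show "(A, B) \<in> (\<Union>(k, l, l') \<in> {(k, l, l'). l \<noteq> l'}. P k l l')" by auto
  qed
  ultimately show ?thesis by (rule negligible_subset)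
qed

theorem theorem3p2:
  "{G :: ('m1::finite, 'm2::finite) bimatrix_game.
      \<exists>x1 x2. strong_nash_equilibrium G (x1, x2) \<and> (non_pure x1 \<or> non_pure x2)}
     \<in> null_sets lebesgue"
proof -
  have "negligible (degenerate_games \<union> prod.swap ` degenerate_games :: ('m1, 'm2) bimatrix_game set)"
    by (intro negligible_Un negligible_swap negligible_degenerate_games)
  moreover have "{G :: ('m1, 'm2) bimatrix_game.
      \<exists>x1 x2. strong_nash_equilibrium G (x1, x2) \<and> (non_pure x1 \<or> non_pure x2)}
    \<subseteq> degenerate_games \<union> prod.swap ` degenerate_games"
  proof clarify
    fix A :: "real ^ 'm2 ^ 'm1" and B :: "real ^ 'm1 ^ 'm2" and x y
    assume strong: "strong_nash_equilibrium (A, B) (x, y)" and mixed: "non_pure x \<or> non_pure y"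
      and notin: "(A, B) \<notin> prod.swap ` degenerate_games"
    from strong have nash: "nash_equilibrium (A, B) (x, y)"
      by (simp add: strong_nash_equilibrium_def)
    note supp = nash_equilibrium_support[OF nash]
    have "(B, A) \<notin> degenerate_games"
      using notin by (metis image_eqI swap_simp)
    \<comment> \<open>If only player 1 mixes, or both mix and player 2 is the indifferent one, the
      exchanged game \<open>(B, A)\<close> would be degenerate with witnesses \<open>y\<close>,
      \<open>x\<close>. In the remaining cases \<open>x\<close>, \<open>y\<close> are witnesses for
      \<open>(A, B)\<close>.\<close>
    then show "(A, B) \<in> degenerate_games"
      using strong_nash_equilibrium_indifferent[OF strong] mixed supp
      unfolding degenerate_games_def mem_Collect_eq case_prod_conv by blast
  qed
  ultimately show ?thesis
    unfolding negligible_iff_null_sets[symmetric] by (rule negligible_subset)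
qed

end
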